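(* Let $\Delta\in(0,1)$. For $\epsilon>0$ and a positive integer $\tau$ consider the evaluation and Jacobian oracle-complexity upper bounds $$E(\epsilon,\tau)=\widetilde{\Theta} \left( (\epsilon^{-3} \tau^{-1} + \epsilon^{-1} \tau^4) \log(1/\Delta) \right),\qquad J(\epsilon,\tau)=\widetilde{\Theta} \left( (\epsilon^{-2} \tau + \epsilon^{-1} \tau^4) \log(1/\Delta) \right).$$ (i) The minimal asymptotic rate of $E$ with respect to the choice of $\tau$ (as a function of $\epsilon$) is $\widetilde{\Theta} (\epsilon^{-13/5} \log(1/\Delta))$, achieved by setting $\tau = \Theta(\epsilon^{-2/5})$. In this case, $J$ is also $\widetilde{\Theta} (\epsilon^{-13/5} \log(1/\Delta))$. (ii) The minimal asymptotic rate of $J$ with respect to the choice of $\tau$ is $\widetilde{\Theta} (\epsilon^{-2} \log(1/\Delta))$, achieved at $\tau = \Theta(1)$. In this case, $E$ is $\widetilde{\Theta} (\epsilon^{-3} \log(1/\Delta))$.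
   Context: Asymptotic notation is with respect to $\epsilon\to0$, and $\widetilde\Theta$ omits multiplicative logarithmic terms in $\epsilon$. Meaning of the quantities: for minimizing $f(g(x))+h(x)$ with $g=\mathbb{E}_{\xi\sim D}[g_\xi]$ by the variance-reduced inexact prox-linear method whose inner loops all have length $\tau$, $E$ and $J$ are the upper bounds (valid when $\tau=O(\epsilon^{-1})$) on the number of evaluations of $g_\xi$ and of Jacobians $g'_\xi$ used to make the average of $\|\mathcal{G}_M\|_2^2$ over the iterates at most $\epsilon$ with probability at least $1-\Delta$, when $g$ and $g'$ are estimated at the $i$-th inner iterate $x_i$ as follows: sample means over large batches at $x_0$ (giving $\widetilde g_0,\widetilde J_0$), and for $i>0$, $\widetilde g_i=\frac1a\sum_{\xi\in\mathcal{A}_i}(g_\xi(x_i)-g_\xi(x_0)-g'_\xi(x_0)(x_i-x_0))+\widetilde g_0+\widetilde J_0(x_i-x_0)$, $\widetilde J_i=\frac1b\sum_{\xi\in\mathcal{B}_i}(g'_\xi(x_i)-g'_\xi(x_0))+\widetilde J_0$ with i.i.d. batches $\mathcal{A}_i,\mathcal{B}_i$ of sizes $a,b$. The claim concerns only the two displayed expressions. *)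

theory Defs
  imports Complex_Main "HOL-Library.Landau_Symbols"
begin

text \<open>
  Soft Landau classes, which ignore factors that are polylogarithmic in a distinguished positive
  quantity \<open>e x\<close> tending to \<open>0\<close> along the filter \<open>F\<close>. Keeping \<open>e\<close> separate
  from the point \<open>x\<close> makes the same definition usable for functions of \<open>\<epsilon>\<close>
  alone and for functions of a pair \<open>(\<epsilon>, \<tau>)\<close>, where logarithms of \<open>\<tau>\<close>
  are not to be ignored.
\<close>

definition soft_bigo :: "('a \<Rightarrow> real) \<Rightarrow> 'a filter \<Rightarrow> ('a \<Rightarrow> real) \<Rightarrow> ('a \<Rightarrow> real) set" where
  "soft_bigo e F g = {f. \<exists>k::nat. f \<in> O[F](\<lambda>x. g x * ln (1 / e x) ^ k)}"

definition soft_bigomega :: "('a \<Rightarrow> real) \<Rightarrow> 'a filter \<Rightarrow> ('a \<Rightarrow> real) \<Rightarrow> ('a \<Rightarrow> real) set" where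
  "soft_bigomega e F g = {f. \<exists>k::nat. f \<in> \<Omega>[F](\<lambda>x. g x / ln (1 / e x) ^ k)}"

definition soft_bigtheta :: "('a \<Rightarrow> real) \<Rightarrow> 'a filter \<Rightarrow> ('a \<Rightarrow> real) \<Rightarrow> ('a \<Rightarrow> real) set" where
  "soft_bigtheta e F g = soft_bigo e F g \<inter> soft_bigomega e F g"

abbreviation soft_Omega :: "(real \<Rightarrow> real) \<Rightarrow> (real \<Rightarrow> real) set" where
  "soft_Omega \<equiv> soft_bigomega (\<lambda>\<epsilon>. \<epsilon>) (at_right 0)"

abbreviation soft_Theta :: "(real \<Rightarrow> real) \<Rightarrow> (real \<Rightarrow> real) set" where
  "soft_Theta \<equiv> soft_bigtheta (\<lambda>\<epsilon>. \<epsilon>) (at_right 0)"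

text \<open>
  The two-variable version: the hidden constants, the power of the logarithm and the threshold on
  \<open>\<epsilon>\<close> are uniform in the positive integer \<open>\<tau>\<close>, so that any function of
  \<open>\<epsilon>\<close> may be substituted for \<open>\<tau>\<close>.
\<close>

abbreviation soft_Theta2 :: "(real \<times> nat \<Rightarrow> real) \<Rightarrow> (real \<times> nat \<Rightarrow> real) set" where
  "soft_Theta2 \<equiv> soft_bigtheta fst (at_right 0 \<times>\<^sub>F principal {1..})"

definition schedules :: "(real \<Rightarrow> nat) set" where
  "schedules = {\<tau>. \<forall>\<epsilon>>0. 1 \<le> \<tau> \<epsilon>}"

text \<open>
  \<open>r\<close> is the smallest order of growth of \<open>C (\<epsilon>, \<tau>)\<close> over all choices of
  \<open>\<tau>\<close> as a function of \<open>\<epsilon>\<close>: a lower bound for every choice, attained by some.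
\<close>

definition minimal_soft_rate :: "(real \<times> nat \<Rightarrow> real) \<Rightarrow> (real \<Rightarrow> real) \<Rightarrow> bool" where
  "minimal_soft_rate C r \<longleftrightarrow>
     (\<forall>\<tau>\<in>schedules. (\<lambda>\<epsilon>. C (\<epsilon>, \<tau> \<epsilon>)) \<in> soft_Omega r) \<and>
     (\<exists>\<tau>\<in>schedules. (\<lambda>\<epsilon>. C (\<epsilon>, \<tau> \<epsilon>)) \<in> soft_Theta r)"

definition schedules_of_order :: "(real \<Rightarrow> real) \<Rightarrow> (real \<Rightarrow> nat) set" where
  "schedules_of_order s = {\<tau>\<in>schedules. (\<lambda>\<epsilon>. real (\<tau> \<epsilon>)) \<in> \<Theta>[at_right 0](s)}"

end

theory Submission
  imports Defs
begin

text \<open>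
  Since the classes are uniform in \<open>\<tau>\<close>, a schedule may be substituted for
  \<open>\<tau>\<close>, which leaves plain asymptotics of functions of \<open>\<epsilon>\<close>.
  The two terms of \<open>E\<close> are respectively decreasing and increasing in
  \<open>\<tau>\<close> and coincide at \<open>\<tau> = \<epsilon> powr (-2/5)\<close>, so at every
  \<open>\<tau>\<close> one of them is at least the common value \<open>\<epsilon> powr (-13/5)\<close>;
  \<open>J\<close> is increasing in \<open>\<tau>\<close>, so its minimum is at \<open>\<tau> = 1\<close>.
\<close>

section \<open>Monotonicity and substitution for the soft Landau classes\<close>

lemma soft_bigomega_mono:
  assumes "f \<in> soft_bigomega e F g" and "g \<in> \<Omega>[F](g')"
  shows "f \<in> soft_bigomega e F g'"
proof -
  obtain k where k: "f \<in> \<Omega>[F](\<lambda>x. g x / ln (1 / e x) ^ k)"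
    using assms(1) by (auto simp: soft_bigomega_def)
  have "(\<lambda>x. g x * inverse (ln (1 / e x) ^ k)) \<in> \<Omega>[F](\<lambda>x. g' x * inverse (ln (1 / e x) ^ k))"
    by (rule landau_omega.big.mult_right[OF assms(2)])
  then have "(\<lambda>x. g x / ln (1 / e x) ^ k) \<in> \<Omega>[F](\<lambda>x. g' x / ln (1 / e x) ^ k)"
    by (simp add: divide_inverse)
  from landau_omega.big.trans[OF k this] show ?thesis
    unfolding soft_bigomega_def by blast
qed

lemma soft_bigo_mono:
  assumes "f \<in> soft_bigo e F g" and "g \<in> O[F](g')"
  shows "f \<in> soft_bigo e F g'"
proof -
  obtain k where k: "f \<in> O[F](\<lambda>x. g x * ln (1 / e x) ^ k)"
    using assms(1) by (auto simp: soft_bigo_def)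
  have "(\<lambda>x. g x * ln (1 / e x) ^ k) \<in> O[F](\<lambda>x. g' x * ln (1 / e x) ^ k)"
    by (rule landau_o.big.mult_right[OF assms(2)])
  from landau_o.big.trans[OF k this] show ?thesis
    unfolding soft_bigo_def by blast
qed

lemma soft_bigtheta_cong:
  assumes "f \<in> soft_bigtheta e F g" and "g \<in> \<Theta>[F](g')"
  shows "f \<in> soft_bigtheta e F g'"
  using assms soft_bigo_mono soft_bigomega_mono
  unfolding soft_bigtheta_def bigtheta_def by blast

text \<open>A Landau bound is an inequality with a fixed constant that holds eventually along
  \<open>F\<close>, so it pulls back along any map whose limit is \<open>F\<close>. The logarithmic
  powers are carried over unchanged.\<close>

lemma soft_bigtheta_compose:
  assumes "f \<in> soft_bigtheta e F g" and h: "filterlim h F G"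
  shows "(\<lambda>x. f (h x)) \<in> soft_bigtheta (\<lambda>x. e (h x)) G (\<lambda>x. g (h x))"
proof -
  obtain k l where k: "f \<in> O[F](\<lambda>x. g x * ln (1 / e x) ^ k)"
    and l: "f \<in> \<Omega>[F](\<lambda>x. g x / ln (1 / e x) ^ l)"
    using assms(1) by (auto simp: soft_bigtheta_def soft_bigo_def soft_bigomega_def)
  show ?thesis
    using landau_o.big.compose[OF k h] landau_omega.big.compose[OF l h]
    by (auto simp: soft_bigtheta_def soft_bigo_def soft_bigomega_def)
qed

text \<open>The graph map of a schedule tends to the product filter: its first component is the
  identity, and convergence to \<open>principal {1..}\<close> asks only for eventual membership, not
  for any growth of \<open>\<tau>\<close>. As \<open>fst\<close> of the graph point is
  \<open>\<epsilon>\<close>, the ignored logarithms remain logarithms in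
  \<open>\<epsilon>\<close>.\<close>

lemma soft_Theta2_schedule:
  assumes "C \<in> soft_Theta2 g" and "\<tau> \<in> schedules"
  shows "(\<lambda>\<epsilon>. C (\<epsilon>, \<tau> \<epsilon>)) \<in> soft_Theta (\<lambda>\<epsilon>. g (\<epsilon>, \<tau> \<epsilon>))"
proof -
  have "eventually (\<lambda>\<epsilon>::real. \<epsilon> > 0) (at_right 0)"
    by (simp add: eventually_at_right_less)
  then have "eventually (\<lambda>\<epsilon>. \<tau> \<epsilon> \<in> {1..}) (at_right 0)"
    by eventually_elim (use assms(2) in \<open>auto simp: schedules_def\<close>)
  then have "filterlim \<tau> (principal {1..}) (at_right 0)"
    by (simp add: filterlim_principal)
  then have "filterlim (\<lambda>\<epsilon>. (\<epsilon>, \<tau> \<epsilon>)) (at_right 0 \<times>\<^sub>F principal {1..}) (at_right 0)"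
    by (intro filterlim_Pair filterlim_ident)
  from soft_bigtheta_compose[OF assms(1) this] show ?thesis
    by simp
qed

section \<open>Ordinary asymptotics: sums, integer rounding and powers of
  \<open>\<epsilon>\<close>\<close>

lemma bigtheta_add_nonneg:
  fixes f g h :: "'a \<Rightarrow> real"
  assumes "f \<in> \<Theta>[F](h)" and "g \<in> O[F](h)" and "\<And>x. 0 \<le> f x" and "\<And>x. 0 \<le> g x"
  shows "(\<lambda>x. f x + g x) \<in> \<Theta>[F](h)"
proof (rule bigthetaI)
  show "(\<lambda>x. f x + g x) \<in> O[F](h)"
    using assms(1,2) by (intro sum_in_bigo) auto
  \<comment> \<open>Nonnegativity rules out cancellation, so the first summand alone supplies the
    lower bound on the sum.\<close>
  have "f \<in> O[F](\<lambda>x. f x + g x)"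
    using assms(3,4) by (intro landau_o.big_mono always_eventually) auto
  then have "(\<lambda>x. f x + g x) \<in> \<Omega>[F](f)"
    by (simp add: bigomega_iff_bigo)
  with assms(1) show "(\<lambda>x. f x + g x) \<in> \<Omega>[F](h)"
    using bigthetaD2 landau_omega.big.trans by blast
qed

text \<open>Rounding \<open>s\<close> up to an integer gives a member. This keeps later claims about
  all schedules of a given order from being vacuous, and supplies the attaining schedules for
  \<open>minimal_soft_rate\<close>.\<close>

lemma schedules_of_order_nonempty:
  assumes "eventually (\<lambda>\<epsilon>. 1 \<le> s \<epsilon>) (at_right 0)"
  shows "schedules_of_order s \<noteq> {}"
proof -
  \<comment> \<open>The \<open>max 1\<close> secures the schedule condition at every positive
    \<open>\<epsilon>\<close>, including those where \<open>s\<close> may lie below 1.\<close>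
  define \<tau> where "\<tau> = (\<lambda>\<epsilon>. max 1 (nat \<lceil>s \<epsilon>\<rceil>))"
  \<comment> \<open>The factor 2 comes from \<open>s + 1 \<le> 2 * s\<close> once
    \<open>1 \<le> s\<close>. The last conjunct serves to remove the norms in the Landau
    bounds.\<close>
  have "eventually (\<lambda>\<epsilon>. s \<epsilon> \<le> real (\<tau> \<epsilon>) \<and> real (\<tau> \<epsilon>) \<le> 2 * s \<epsilon> \<and> 0 \<le> s \<epsilon>) (at_right 0)"
    using assms by eventually_elim (unfold \<tau>_def, linarith)
  then have "(\<lambda>\<epsilon>. real (\<tau> \<epsilon>)) \<in> \<Theta>[at_right 0](s)"
    by (intro bigthetaI landau_o.bigI[of 2] landau_omega.bigI[of 1]) (auto elim!: eventually_mono)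
  then have "\<tau> \<in> schedules_of_order s"
    by (auto simp: schedules_of_order_def schedules_def \<tau>_def)
  then show ?thesis
    by blast
qed

lemma eventually_at_right_0_lt_1: "eventually (\<lambda>\<epsilon>::real. 0 < \<epsilon> \<and> \<epsilon> < 1) (at_right 0)"
  by (auto simp: eventually_at_right_field intro: exI[of _ 1])

text \<open>On \<open>0 < \<epsilon> < 1\<close> a power with smaller exponent is the larger one, so
  the constant 1 suffices.\<close>

lemma powr_bigo_at_right_0:
  assumes "b \<le> (a::real)"
  shows "(\<lambda>\<epsilon>::real. \<epsilon> powr a) \<in> O[at_right 0](\<lambda>\<epsilon>. \<epsilon> powr b)"
  using eventually_at_right_0_lt_1
  by (intro landau_o.big_mono, elim eventually_mono) (use assms in \<open>auto intro: powr_mono'\<close>)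

text \<open>Orders multiply, so exponents add. The case \<open>n = 1\<close> serves the linear term
  of the Jacobian bound, the case \<open>n = 4\<close> the quartic term of both bounds.\<close>

lemma bigtheta_powr_times_power:
  fixes t :: "real \<Rightarrow> real"
  assumes "t \<in> \<Theta>[at_right 0](\<lambda>\<epsilon>. \<epsilon> powr p)"
  shows "(\<lambda>\<epsilon>. \<epsilon> powr a * t \<epsilon> ^ n) \<in> \<Theta>[at_right 0](\<lambda>\<epsilon>. \<epsilon> powr (a + real n * p))"
proof -
  have "(\<lambda>\<epsilon>. t \<epsilon> ^ n) \<in> \<Theta>[at_right 0](\<lambda>\<epsilon>. (\<epsilon> powr p) ^ n)"
    using assms unfolding bigtheta_def
    by (auto intro: landau_o.big_power landau_omega.big_power)
  then have "(\<lambda>\<epsilon>. \<epsilon> powr a * t \<epsilon> ^ n) \<in> \<Theta>[at_right 0](\<lambda>\<epsilon>. \<epsilon> powr a * (\<epsilon> powr p) ^ n)"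
    by (intro landau_theta.mult bigtheta_refl)
  moreover have "(\<epsilon> powr p) ^ n = \<epsilon> powr (real n * p)" if "\<epsilon> > 0" for \<epsilon> :: real
    using that by (simp add: powr_realpow[symmetric] powr_powr mult.commute)
  then have eq: "eventually (\<lambda>\<epsilon>. \<epsilon> powr a * (\<epsilon> powr p) ^ n = \<epsilon> powr (a + real n * p)) (at_right 0)"
    using eventually_at_right_0_lt_1 by (elim eventually_mono) (simp add: powr_add)
  ultimately show ?thesis
    unfolding landau_theta.cong[OF eq] by blast
qed

lemma bigtheta_powr_times_inverse:
  fixes t :: "real \<Rightarrow> real"
  assumes "t \<in> \<Theta>[at_right 0](\<lambda>\<epsilon>. \<epsilon> powr p)"
  shows "(\<lambda>\<epsilon>. \<epsilon> powr a * inverse (t \<epsilon>)) \<in> \<Theta>[at_right 0](\<lambda>\<epsilon>. \<epsilon> powr (a - p))"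
proof -
  have "(\<lambda>\<epsilon>. \<epsilon> powr a * inverse (t \<epsilon>)) \<in> \<Theta>[at_right 0](\<lambda>\<epsilon>. \<epsilon> powr a * inverse (\<epsilon> powr p))"
    using assms by (intro landau_theta.mult bigtheta_refl) simp
  then show ?thesis
    by (simp add: powr_diff divide_inverse)
qed

section \<open>Pointwise lower bounds for the two complexity expressions\<close>

lemma evaluation_rate_lower_bound:
  assumes "0 < \<epsilon>" and "0 < (t::real)"
  shows "\<epsilon> powr (-13/5) \<le> \<epsilon> powr (-3) * inverse t + \<epsilon> powr (-1) * t ^ 4"
\<comment> \<open>Equating the two terms gives \<open>t ^ 5 = \<epsilon> powr (-2)\<close>, hence
  this split point. There the exponents are \<open>-3 + 2/5\<close> and \<open>-1 - 8/5\<close>,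
  both equal to \<open>-13/5\<close>. Below it the decreasing term suffices, above it the increasing
  one.\<close>
proof (cases "t \<le> \<epsilon> powr (-2/5)")
  case True
  have "\<epsilon> powr (-13/5) = \<epsilon> powr (-3) * inverse (\<epsilon> powr (-2/5))"
    by (simp add: powr_minus[symmetric] powr_add[symmetric])
  also have "\<dots> \<le> \<epsilon> powr (-3) * inverse t"
    using assms True by (intro mult_left_mono le_imp_inverse_le) auto
  also have "\<dots> \<le> \<epsilon> powr (-3) * inverse t + \<epsilon> powr (-1) * t ^ 4"
    by simp
  finally show ?thesis .
next
  case False
  have "(\<epsilon> powr (-2/5)) ^ 4 = \<epsilon> powr (-8/5)"
    using assms by (simp add: powr_realpow[symmetric] powr_powr)
  then have "\<epsilon> powr (-13/5) = \<epsilon> powr (-1) * (\<epsilon> powr (-2/5)) ^ 4"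
    using powr_add[of \<epsilon> "-1" "-8/5"] by simp
  also have "\<dots> \<le> \<epsilon> powr (-1) * t ^ 4"
    using False by (intro mult_left_mono power_mono) auto
  also have "\<dots> \<le> \<epsilon> powr (-3) * inverse t + \<epsilon> powr (-1) * t ^ 4"
    using assms by simp
  finally show ?thesis .
qed

lemma jacobian_rate_lower_bound:
  assumes "1 \<le> (t::real)"
  shows "\<epsilon> powr (-2) \<le> \<epsilon> powr (-2) * t + \<epsilon> powr (-1) * t ^ 4"
proof -
  have "\<epsilon> powr (-2) * 1 \<le> \<epsilon> powr (-2) * t"
    using assms by (intro mult_left_mono) auto
  then show ?thesis
    by (simp add: add_increasing2)
qed

section \<open>Minimal rates and the schedules attaining them\<close>

theorem corollary3p11:
  fixes \<Delta> :: real and E J :: "real \<times> nat \<Rightarrow> real"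
  assumes "0 < \<Delta>" and "\<Delta> < 1"
    and "E \<in> soft_Theta2 (\<lambda>(\<epsilon>, \<tau>).
           (\<epsilon> powr (-3) * inverse (real \<tau>) + \<epsilon> powr (-1) * real \<tau> ^ 4) * ln (1 / \<Delta>))"
    and "J \<in> soft_Theta2 (\<lambda>(\<epsilon>, \<tau>).
           (\<epsilon> powr (-2) * real \<tau> + \<epsilon> powr (-1) * real \<tau> ^ 4) * ln (1 / \<Delta>))"
  shows "(minimal_soft_rate E (\<lambda>\<epsilon>. \<epsilon> powr (-13/5) * ln (1 / \<Delta>)) \<and>
          schedules_of_order (\<lambda>\<epsilon>. \<epsilon> powr (-2/5)) \<noteq> {} \<and>
          (\<forall>\<tau>\<in>schedules_of_order (\<lambda>\<epsilon>. \<epsilon> powr (-2/5)).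
             (\<lambda>\<epsilon>. E (\<epsilon>, \<tau> \<epsilon>)) \<in> soft_Theta (\<lambda>\<epsilon>. \<epsilon> powr (-13/5) * ln (1 / \<Delta>)) \<and>
             (\<lambda>\<epsilon>. J (\<epsilon>, \<tau> \<epsilon>)) \<in> soft_Theta (\<lambda>\<epsilon>. \<epsilon> powr (-13/5) * ln (1 / \<Delta>))))
       \<and> (minimal_soft_rate J (\<lambda>\<epsilon>. \<epsilon> powr (-2) * ln (1 / \<Delta>)) \<and>
          schedules_of_order (\<lambda>\<epsilon>. 1) \<noteq> {} \<and>
          (\<forall>\<tau>\<in>schedules_of_order (\<lambda>\<epsilon>. 1).
             (\<lambda>\<epsilon>. J (\<epsilon>, \<tau> \<epsilon>)) \<in> soft_Theta (\<lambda>\<epsilon>. \<epsilon> powr (-2) * ln (1 / \<Delta>)) \<and>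
             (\<lambda>\<epsilon>. E (\<epsilon>, \<tau> \<epsilon>)) \<in> soft_Theta (\<lambda>\<epsilon>. \<epsilon> powr (-3) * ln (1 / \<Delta>))))"
proof -
  define L where "L = ln (1 / \<Delta>)"
  define gE :: "real \<Rightarrow> real \<Rightarrow> real"
    where "gE = (\<lambda>\<epsilon> t. \<epsilon> powr (-3) * inverse t + \<epsilon> powr (-1) * t ^ 4)"
  define gJ :: "real \<Rightarrow> real \<Rightarrow> real"
    where "gJ = (\<lambda>\<epsilon> t. \<epsilon> powr (-2) * t + \<epsilon> powr (-1) * t ^ 4)"

  have E: "(\<lambda>\<epsilon>. E (\<epsilon>, \<tau> \<epsilon>)) \<in> soft_Theta (\<lambda>\<epsilon>. gE \<epsilon> (real (\<tau> \<epsilon>)) * L)"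
    if "\<tau> \<in> schedules" for \<tau>
    using soft_Theta2_schedule[OF assms(3) that] by (simp add: gE_def L_def)
  have J: "(\<lambda>\<epsilon>. J (\<epsilon>, \<tau> \<epsilon>)) \<in> soft_Theta (\<lambda>\<epsilon>. gJ \<epsilon> (real (\<tau> \<epsilon>)) * L)"
    if "\<tau> \<in> schedules" for \<tau>
    using soft_Theta2_schedule[OF assms(4) that] by (simp add: gJ_def L_def)

  \<comment> \<open>The pointwise bound has constant 1 whatever the value of
    \<open>\<tau> \<epsilon>\<close>, so it covers schedules of any growth, even irregular
    ones.\<close>
  have E_lower: "(\<lambda>\<epsilon>. E (\<epsilon>, \<tau> \<epsilon>)) \<in> soft_Omega (\<lambda>\<epsilon>. \<epsilon> powr (-13/5) * L)"
    if \<tau>: "\<tau> \<in> schedules" for \<tau>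
  proof -
    have "eventually (\<lambda>\<epsilon>. norm (\<epsilon> powr (-13/5)) \<le> norm (gE \<epsilon> (real (\<tau> \<epsilon>)))) (at_right 0)"
      using eventually_at_right_0_lt_1
    proof eventually_elim
      case (elim \<epsilon>)
      then have "0 < real (\<tau> \<epsilon>)"
        using \<tau> by (force simp: schedules_def)
      with elim have "\<epsilon> powr (-13/5) \<le> gE \<epsilon> (real (\<tau> \<epsilon>))"
        unfolding gE_def by (intro evaluation_rate_lower_bound) auto
      then show ?case
        by simp
    qed
    then have "(\<lambda>\<epsilon>. gE \<epsilon> (real (\<tau> \<epsilon>)) * L) \<in> \<Omega>[at_right 0](\<lambda>\<epsilon>. \<epsilon> powr (-13/5) * L)"
      by (intro landau_omega.big.mult_right landau_omega.bigI[of 1]) auto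
    with E[OF \<tau>] show ?thesis
      using soft_bigomega_mono by (auto simp: soft_bigtheta_def)
  qed

  have J_lower: "(\<lambda>\<epsilon>. J (\<epsilon>, \<tau> \<epsilon>)) \<in> soft_Omega (\<lambda>\<epsilon>. \<epsilon> powr (-2) * L)"
    if \<tau>: "\<tau> \<in> schedules" for \<tau>
  proof -
    have "eventually (\<lambda>\<epsilon>. norm (\<epsilon> powr (-2)) \<le> norm (gJ \<epsilon> (real (\<tau> \<epsilon>)))) (at_right 0)"
      using eventually_at_right_0_lt_1
    proof eventually_elim
      case (elim \<epsilon>)
      then have "1 \<le> real (\<tau> \<epsilon>)"
        using \<tau> by (force simp: schedules_def)
      then have "\<epsilon> powr (-2) \<le> gJ \<epsilon> (real (\<tau> \<epsilon>))"
        unfolding gJ_def by (rule jacobian_rate_lower_bound)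
      then show ?case
        by simp
    qed
    then have "(\<lambda>\<epsilon>. gJ \<epsilon> (real (\<tau> \<epsilon>)) * L) \<in> \<Omega>[at_right 0](\<lambda>\<epsilon>. \<epsilon> powr (-2) * L)"
      by (intro landau_omega.big.mult_right landau_omega.bigI[of 1]) auto
    with J[OF \<tau>] show ?thesis
      using soft_bigomega_mono by (auto simp: soft_bigtheta_def)
  qed

  \<comment> \<open>From here on it is enough to find the ordinary order of \<open>gE\<close> and
    \<open>gJ\<close> along a schedule; the factor \<open>L\<close> is carried along by
    multiplication.\<close>
  have E_rate: "(\<lambda>\<epsilon>. E (\<epsilon>, \<tau> \<epsilon>)) \<in> soft_Theta (\<lambda>\<epsilon>. \<epsilon> powr r * L)"
    if "\<tau> \<in> schedules" and "(\<lambda>\<epsilon>. gE \<epsilon> (real (\<tau> \<epsilon>))) \<in> \<Theta>[at_right 0](\<lambda>\<epsilon>. \<epsilon> powr r)" for \<tau> r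
    using E[OF that(1)] landau_theta.mult[OF that(2) bigtheta_refl] by (rule soft_bigtheta_cong)
  have J_rate: "(\<lambda>\<epsilon>. J (\<epsilon>, \<tau> \<epsilon>)) \<in> soft_Theta (\<lambda>\<epsilon>. \<epsilon> powr r * L)"
    if "\<tau> \<in> schedules" and "(\<lambda>\<epsilon>. gJ \<epsilon> (real (\<tau> \<epsilon>))) \<in> \<Theta>[at_right 0](\<lambda>\<epsilon>. \<epsilon> powr r)" for \<tau> r
    using J[OF that(1)] landau_theta.mult[OF that(2) bigtheta_refl] by (rule soft_bigtheta_cong)

  have balanced: "(\<lambda>\<epsilon>. E (\<epsilon>, \<tau> \<epsilon>)) \<in> soft_Theta (\<lambda>\<epsilon>. \<epsilon> powr (-13/5) * L) \<and>
      (\<lambda>\<epsilon>. J (\<epsilon>, \<tau> \<epsilon>)) \<in> soft_Theta (\<lambda>\<epsilon>. \<epsilon> powr (-13/5) * L)"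
    if "\<tau> \<in> schedules_of_order (\<lambda>\<epsilon>. \<epsilon> powr (-2/5))" for \<tau>
  proof -
    have \<tau>: "\<tau> \<in> schedules" "(\<lambda>\<epsilon>. real (\<tau> \<epsilon>)) \<in> \<Theta>[at_right 0](\<lambda>\<epsilon>. \<epsilon> powr (-2/5))"
      using that by (auto simp: schedules_of_order_def)
    have inv: "(\<lambda>\<epsilon>. \<epsilon> powr (-3) * inverse (real (\<tau> \<epsilon>))) \<in> \<Theta>[at_right 0](\<lambda>\<epsilon>. \<epsilon> powr (-13/5))"
      using bigtheta_powr_times_inverse[OF \<tau>(2), of "-3"] by simp
    have lin: "(\<lambda>\<epsilon>. \<epsilon> powr (-2) * real (\<tau> \<epsilon>)) \<in> \<Theta>[at_right 0](\<lambda>\<epsilon>. \<epsilon> powr (-12/5))"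
      using bigtheta_powr_times_power[OF \<tau>(2), of "-2" 1] by simp
    have quart: "(\<lambda>\<epsilon>. \<epsilon> powr (-1) * real (\<tau> \<epsilon>) ^ 4) \<in> \<Theta>[at_right 0](\<lambda>\<epsilon>. \<epsilon> powr (-13/5))"
      using bigtheta_powr_times_power[OF \<tau>(2), of "-1" 4] by simp
    have "(\<lambda>\<epsilon>. \<epsilon> powr (-2) * real (\<tau> \<epsilon>)) \<in> O[at_right 0](\<lambda>\<epsilon>. \<epsilon> powr (-13/5))"
      using bigthetaD1[OF lin] powr_bigo_at_right_0 by (rule landau_o.big.trans) simp
    \<comment> \<open>For \<open>J\<close> the quartic term, of exponent \<open>-13/5\<close>,
      dominates the linear one, of exponent \<open>-12/5\<close>. The summands are swapped because
      \<open>bigtheta_add_nonneg\<close> expects the term of exact order first.\<close>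
    with quart have "(\<lambda>\<epsilon>. \<epsilon> powr (-1) * real (\<tau> \<epsilon>) ^ 4 + \<epsilon> powr (-2) * real (\<tau> \<epsilon>))
        \<in> \<Theta>[at_right 0](\<lambda>\<epsilon>. \<epsilon> powr (-13/5))"
      by (rule bigtheta_add_nonneg) auto
    then have "(\<lambda>\<epsilon>. gJ \<epsilon> (real (\<tau> \<epsilon>))) \<in> \<Theta>[at_right 0](\<lambda>\<epsilon>. \<epsilon> powr (-13/5))"
      by (simp add: gJ_def add.commute)
    moreover have "(\<lambda>\<epsilon>. gE \<epsilon> (real (\<tau> \<epsilon>))) \<in> \<Theta>[at_right 0](\<lambda>\<epsilon>. \<epsilon> powr (-13/5))"
      unfolding gE_def using inv bigthetaD1[OF quart] by (rule bigtheta_add_nonneg) auto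
    ultimately show ?thesis
      using E_rate[OF \<tau>(1)] J_rate[OF \<tau>(1)] by simp
  qed

  have const: "(\<lambda>\<epsilon>. J (\<epsilon>, \<tau> \<epsilon>)) \<in> soft_Theta (\<lambda>\<epsilon>. \<epsilon> powr (-2) * L) \<and>
      (\<lambda>\<epsilon>. E (\<epsilon>, \<tau> \<epsilon>)) \<in> soft_Theta (\<lambda>\<epsilon>. \<epsilon> powr (-3) * L)"
    if "\<tau> \<in> schedules_of_order (\<lambda>\<epsilon>. 1)" for \<tau>
  proof -
    \<comment> \<open>Constant order is the case \<open>p = 0\<close> of the power lemmas. The
      equality is only eventual, since \<open>0 powr 0 = 0\<close>.\<close>
    have "eventually (\<lambda>\<epsilon>::real. 1 = \<epsilon> powr 0) (at_right 0)"
      using eventually_at_right_0_lt_1 by (elim eventually_mono) auto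
    note one = landau_theta.cong[OF this]
    have \<tau>: "\<tau> \<in> schedules" "(\<lambda>\<epsilon>. real (\<tau> \<epsilon>)) \<in> \<Theta>[at_right 0](\<lambda>\<epsilon>. \<epsilon> powr 0)"
      using that unfolding schedules_of_order_def one by blast+
    have inv: "(\<lambda>\<epsilon>. \<epsilon> powr (-3) * inverse (real (\<tau> \<epsilon>))) \<in> \<Theta>[at_right 0](\<lambda>\<epsilon>. \<epsilon> powr (-3))"
      using bigtheta_powr_times_inverse[OF \<tau>(2), of "-3"] by simp
    have lin: "(\<lambda>\<epsilon>. \<epsilon> powr (-2) * real (\<tau> \<epsilon>)) \<in> \<Theta>[at_right 0](\<lambda>\<epsilon>. \<epsilon> powr (-2))"
      using bigtheta_powr_times_power[OF \<tau>(2), of "-2" 1] by simp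
    \<comment> \<open>For bounded \<open>\<tau>\<close> the quartic term has exponent
      \<open>-1\<close>. Leaving \<open>r\<close> free lets one bound serve both \<open>J\<close>,
      with \<open>r = -2\<close>, and \<open>E\<close>, with \<open>r = -3\<close>.\<close>
    have quart: "(\<lambda>\<epsilon>. \<epsilon> powr (-1) * real (\<tau> \<epsilon>) ^ 4) \<in> O[at_right 0](\<lambda>\<epsilon>. \<epsilon> powr r)"
      if "r \<le> -1" for r
    proof -
      have "(\<lambda>\<epsilon>. \<epsilon> powr (-1) * real (\<tau> \<epsilon>) ^ 4) \<in> O[at_right 0](\<lambda>\<epsilon>. \<epsilon> powr (-1))"
        using bigtheta_powr_times_power[OF \<tau>(2), of "-1" 4] by (intro bigthetaD1) simp
      then show ?thesis
        using powr_bigo_at_right_0[OF that] by (rule landau_o.big.trans)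
    qed
    have "(\<lambda>\<epsilon>. gJ \<epsilon> (real (\<tau> \<epsilon>))) \<in> \<Theta>[at_right 0](\<lambda>\<epsilon>. \<epsilon> powr (-2))"
      unfolding gJ_def using lin quart by (rule bigtheta_add_nonneg) auto
    moreover have "(\<lambda>\<epsilon>. gE \<epsilon> (real (\<tau> \<epsilon>))) \<in> \<Theta>[at_right 0](\<lambda>\<epsilon>. \<epsilon> powr (-3))"
      unfolding gE_def using inv quart by (rule bigtheta_add_nonneg) auto
    ultimately show ?thesis
      using E_rate[OF \<tau>(1)] J_rate[OF \<tau>(1)] by simp
  qed

  have "eventually (\<lambda>\<epsilon>::real. 1 \<le> \<epsilon> powr (-2/5)) (at_right 0)"
    using eventually_at_right_0_lt_1
  proof eventually_elim
    case (elim \<epsilon>)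
    then show ?case
      using powr_mono'[of "-2/5" 0 \<epsilon>] by simp
  qed
  then have ne: "schedules_of_order (\<lambda>\<epsilon>. \<epsilon> powr (-2/5)) \<noteq> {}"
    by (rule schedules_of_order_nonempty)
  have ne1: "schedules_of_order (\<lambda>\<epsilon>. 1) \<noteq> {}"
    by (rule schedules_of_order_nonempty) simp
  have sub: "schedules_of_order s \<subseteq> schedules" for s
    by (auto simp: schedules_of_order_def)
  \<comment> \<open>Any member of the nonempty class of order \<open>\<epsilon> powr (-2/5)\<close>
    witnesses attainment, by \<open>balanced\<close>.\<close>
  have "minimal_soft_rate E (\<lambda>\<epsilon>. \<epsilon> powr (-13/5) * L)"
    unfolding minimal_soft_rate_def using E_lower balanced ne sub by blast
  moreover have "minimal_soft_rate J (\<lambda>\<epsilon>. \<epsilon> powr (-2) * L)"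
    unfolding minimal_soft_rate_def using J_lower const ne1 sub by blast
  ultimately show ?thesis
    unfolding L_def[symmetric] using balanced const ne ne1 by blast
qed

end
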